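(* For each $n$ let $n_1=n_1(n)$ and $n_2=n_2(n)$ with $n_1+n_2=n$, let $\Lambda_1,\Lambda_2$ be disjoint sets of nodes with $|\Lambda_1|=n_1$, $|\Lambda_2|=n_2$, and let $\mathcal{G}_{n_1,n_2}$ be the set of all bi-partite graphs with layers $\Lambda_1,\Lambda_2$. Let $\vec{k}^*_{1\to2}=(k_i^* )_{i\in\Lambda_1}$ be a degree sequence of the top layer $\Lambda_1$ realised by at least one graph in $\mathcal{G}_{n_1,n_2}$, and consider the microcanonical and canonical ensembles $P_{\mathrm{mic}},P_{\mathrm{can}}$ on $\mathcal{G}_{n_1,n_2}$ with constraint $\vec{C}^*=\vec{k}^*_{1\to2}$ on the degree sequence of the top layer only (the degrees in $\Lambda_2$ are unconstrained). Put $f_{n_1}=n_1^{-1}\sum_{i\in\Lambda_1}\delta_{k_i^*}$ and suppose that there exists a probability distribution $f$ on $\mathbb{N}_0$ such that $$\lim_{n\to\infty}\|f_{n_1}-f\|_{\ell^1(g)}=0.$$ Let $s_{n_1+n_2}=\frac{S_{n_1+n_2}(P_{\mathrm{mic}}\mid P_{\mathrm{can}})}{n_1+n_2}$, $s_\infty=\lim_{n\to\infty}s_{n_1+n_2}$ and $c=\lim_{n\to\infty}\frac{n_2}{n_1}\in[0,\infty]$. Then: (1) If $n_2\to\infty$ as $n\to\infty$ with $n_1$ fixed ($c=\infty$), then $s_\infty=0$. (2) If $n_1,n_2\to\infty$ as $n\to\infty$ with $c=\infty$, then $s_\infty=0$. (3) If $n_1\to\infty$ as $n\to\infty$ with $n_2$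 fixed ($c=0$), then $s_\infty=\|f\|_{\ell^1(g_{n_2})}$. (4) If $n_1,n_2\to\infty$ as $n\to\infty$ with $c\in[0,\infty)$, then $s_\infty=\frac{1}{1+c}\,\|f\|_{\ell^1(g)}$.
   Context: $\mathbb{N}_0=\{0,1,2,\ldots\}$; $\delta_k$ is the point measure at $k$. Graphs are simple and undirected, with adjacency entries $g_{i,j}(\mathbf{G})\in\{0,1\}$. A graph is bi-partite with layers $\Lambda_1,\Lambda_2$ if its node set is $\Lambda_1\cup\Lambda_2$ and $g_{i,j}(\mathbf{G})=0$ whenever $i,j\in\Lambda_1$ or $i,j\in\Lambda_2$. The degree sequence of the top layer is $\vec k_{1\to2}(\mathbf{G})=(\sum_{j\in\Lambda_2}g_{i,j}(\mathbf{G}))_{i\in\Lambda_1}$. Ensembles: given a finite set $\mathcal{G}$ of graphs, a vector-valued function $\vec C$ on $\mathcal{G}$ and a value $\vec C^*$ attained by $\vec C$ for at least one graph in $\mathcal{G}$, the microcanonical distribution is $P_{\mathrm{mic}}(\mathbf{G})=1/\Omega_{\vec C^*}$ if $\vec C(\mathbf{G})=\vec C^*$ and $0$ otherwise, where $\Omega_{\vec C^*}=|\{\mathbf{G}\in\mathcal{G}\colon\vec C(\mathbf{G})=\vec C^*\}|$. The canonical distribution $P_{\mathrm{can}}$ is the probability distribution on $\mathcal{G}$ that maximises the entropy $-\sum_{\mathbf{G}\in\mathcal{G}}P(\mathbf{G})\ln P(\mathbf{G})$ subject to $\sum_{\mathbf{G}\in\mathcal{G}}P(\mathbf{G})\,\vec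 C(\mathbf{G})=\vec C^*$; it has the form $P_{\mathrm{can}}(\mathbf{G})=e^{-\vec\theta^*\cdot\vec C(\mathbf{G})}/Z(\vec\theta^* )$ with $Z(\vec\theta)=\sum_{\mathbf{G}\in\mathcal{G}}e^{-\vec\theta\cdot\vec C(\mathbf{G})}$ and $\vec\theta^*$ chosen such that the average of $\vec C$ equals $\vec C^*$. The relative entropy, with $n=n_1+n_2$ the number of nodes, is $S_n(P_{\mathrm{mic}}\mid P_{\mathrm{can}})=\sum_{\mathbf{G}\in\mathcal{G}}P_{\mathrm{mic}}(\mathbf{G})\ln\frac{P_{\mathrm{mic}}(\mathbf{G})}{P_{\mathrm{can}}(\mathbf{G})}$. The function $g\colon\mathbb{N}_0\to[0,\infty)$ is $g(k)=\log\left(\frac{k!}{k^ke^{-k}}\right)$ (so $g(0)=0$). For $m\in\mathbb{N}$ the function $g_m\colon\mathbb{N}_0\to[0,\infty)$ is $g_m(k)=-\log\left[\mathrm{Bin}(m,\tfrac{k}{m})(k)\right]$ for $0\le k\le m$ and $g_m(k)=0$ for $k>m$, where $\mathrm{Bin}(m,\tfrac{k}{m})(k)=\binom{m}{k}\left(\tfrac{k}{m}\right)^k\left(\tfrac{m-k}{m}\right)^{m-k}$ (with $0\log 0=0$, i.e. $0^0=1$). For a nonnegative weight $w$ on $\mathbb{N}_0$, $\|h\|_{\ell^1(w)}=\sum_{k\in\mathbb{N}_0}|h(k)|\,w(k)$. *)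

theory Defs
  imports "HOL-Probability.Probability_Mass_Function"
begin

section \<open>Bi-partite graphs\<close>

text \<open>A simple undirected graph is represented by its set of edges, each edge being a set of two
  nodes; the node set is carried along explicitly.\<close>

type_synonym 'v graph = "'v set set"

definition simple_graphs :: "'v set \<Rightarrow> 'v graph set" where
  "simple_graphs V = {G. \<forall>e\<in>G. e \<subseteq> V \<and> card e = 2}"

definition adj :: "'v graph \<Rightarrow> 'v \<Rightarrow> 'v \<Rightarrow> nat" where
  "adj G i j = of_bool ({i, j} \<in> G)"

definition bipartite_graphs :: "'v set \<Rightarrow> 'v set \<Rightarrow> 'v graph set" where
  "bipartite_graphs L1 L2 =
     {G \<in> simple_graphs (L1 \<union> L2).
        \<forall>i j. (i \<in> L1 \<and> j \<in> L1) \<or> (i \<in> L2 \<and> j \<in> L2) \<longrightarrow> adj G i j = 0}"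

definition top_degree :: "'v set \<Rightarrow> 'v graph \<Rightarrow> 'v \<Rightarrow> nat" where
  "top_degree L2 G i = (\<Sum>j\<in>L2. adj G i j)"

section \<open>Microcanonical and canonical ensembles\<close>

text \<open>Throughout, \<open>\<G>\<close> is a finite set of configurations, and the constraint is a vector-valued
  function whose components \<open>C G i\<close> are indexed by \<open>i \<in> I\<close>.\<close>

definition microcanonical ::
  "'g set \<Rightarrow> 'i set \<Rightarrow> ('g \<Rightarrow> 'i \<Rightarrow> real) \<Rightarrow> ('i \<Rightarrow> real) \<Rightarrow> 'g pmf" where
  "microcanonical \<G> I C Cstar = pmf_of_set {G \<in> \<G>. \<forall>i\<in>I. C G i = Cstar i}"

text \<open>Since \<open>ln 0 = 0\<close>, configurations of probability zero contribute zero below.\<close>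

definition shannon_entropy :: "'g set \<Rightarrow> 'g pmf \<Rightarrow> real" where
  "shannon_entropy \<G> P = - (\<Sum>G\<in>\<G>. pmf P G * ln (pmf P G))"

definition satisfies_on_average ::
  "'g set \<Rightarrow> 'i set \<Rightarrow> ('g \<Rightarrow> 'i \<Rightarrow> real) \<Rightarrow> ('i \<Rightarrow> real) \<Rightarrow> 'g pmf \<Rightarrow> bool" where
  "satisfies_on_average \<G> I C Cstar P \<longleftrightarrow>
     set_pmf P \<subseteq> \<G> \<and> (\<forall>i\<in>I. (\<Sum>G\<in>\<G>. pmf P G * C G i) = Cstar i)"

text \<open>The canonical ensemble is the entropy maximiser itself, not its exponential form
  \<open>exp (- \<theta> \<bullet> C G) / Z \<theta>\<close>: when \<open>Cstar\<close> is extremal (for degrees, when some node has degree zero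
  or is joined to the whole opposite layer), the maximiser exists but has no finite parameter
  \<open>\<theta>\<close>.\<close>

definition canonical ::
  "'g set \<Rightarrow> 'i set \<Rightarrow> ('g \<Rightarrow> 'i \<Rightarrow> real) \<Rightarrow> ('i \<Rightarrow> real) \<Rightarrow> 'g pmf" where
  "canonical \<G> I C Cstar =
     (THE P. is_arg_max (shannon_entropy \<G>) (satisfies_on_average \<G> I C Cstar) P)"

definition relative_entropy :: "'g set \<Rightarrow> 'g pmf \<Rightarrow> 'g pmf \<Rightarrow> real" where
  "relative_entropy \<G> P Q = (\<Sum>G\<in>\<G>. pmf P G * ln (pmf P G / pmf Q G))"

definition top_degree_relative_entropy :: "'v set \<Rightarrow> 'v set \<Rightarrow> ('v \<Rightarrow> nat) \<Rightarrow> real" where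
  "top_degree_relative_entropy L1 L2 k =
     (let \<G> = bipartite_graphs L1 L2;
          C = (\<lambda>G i. real (top_degree L2 G i));
          Cstar = (\<lambda>i. real (k i))
      in relative_entropy \<G> (microcanonical \<G> L1 C Cstar) (canonical \<G> L1 C Cstar))"

section \<open>Weights, norms and empirical degree distributions\<close>

text \<open>In both weights, \<open>0 ^ 0 = 1\<close> takes care of the boundary values of \<open>k\<close>.\<close>

definition g_weight :: "nat \<Rightarrow> real" where
  "g_weight k = ln (fact k / (real k ^ k * exp (- real k)))"

definition gm_weight :: "nat \<Rightarrow> nat \<Rightarrow> real" where
  "gm_weight m k =
     (if k \<le> m
      then - ln (real (m choose k) * (real k / real m) ^ k * (real (m - k) / real m) ^ (m - k))
      else 0)"

text \<open>The norm is extended-real valued, so that it is infinite (rather than an arbitrary real) when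
  the series diverges.\<close>

definition l1_norm :: "(nat \<Rightarrow> real) \<Rightarrow> (nat \<Rightarrow> real) \<Rightarrow> ereal" where
  "l1_norm w h = (\<Sum>k. ereal (\<bar>h k\<bar> * w k))"

definition empirical_degree_distribution :: "'v set \<Rightarrow> ('v \<Rightarrow> nat) \<Rightarrow> nat \<Rightarrow> real" where
  "empirical_degree_distribution L1 k x = (\<Sum>i\<in>L1. indicator {k i} x) / real (card L1)"

end

theory Submission
  imports Defs "HOL-Analysis.Weierstrass_Theorems" "HOL-Real_Asymp.Real_Asymp"
begin

text \<open>The canonical ensemble makes all edges independent, those at \<open>i \<in> L1\<close> having probability
  \<open>k i / n2\<close>: this distribution meets the constraint, and its cross entropy with any other admissible
  distribution equals its own entropy, so Gibbs' inequality makes it the unique entropy maximiser. It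
  is constant on the graphs with top degrees \<open>k\<close>, hence the relative entropy is minus the logarithm
  of the probability that it gives to those graphs, which is the sum of \<open>gm_weight n2 (k i)\<close>
  over \<open>i \<in> L1\<close>.

  For \<open>k \<le> m\<close> one has \<open>gm_weight m k = g_weight k + g_weight (m - k) - g_weight m\<close>. Since
  \<open>g_weight\<close> is increasing with increments tending to 0, this is at most \<open>g_weight k\<close> and tends to it
  as \<open>m\<close> grows. Dominated convergence with dominating function \<open>g_weight\<close> then yields the limit of
  the average over \<open>L1\<close>, which is finally multiplied by the limit of \<open>n1 / (n1 + n2)\<close>.\<close>

section \<open>Gibbs' inequality and entropy maximisers\<close>

text \<open>The inequality \<open>ln t \<le> t - 1\<close> at \<open>t = pmf Q x / pmf P x\<close>,
  times \<open>pmf P x\<close>; equality holds only for \<open>t = 1\<close>. Inclusion of the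
  supports excludes \<open>pmf Q x = 0 < pmf P x\<close>, where \<open>ln 0 = 0\<close> would
  falsify the bound.\<close>

lemma pmf_ln_diff_le:
  assumes "set_pmf P \<subseteq> set_pmf Q"
  shows "pmf P x * ln (pmf Q x) - pmf P x * ln (pmf P x) \<le> pmf Q x - pmf P x"
    and "pmf P x \<noteq> pmf Q x \<Longrightarrow>
      pmf P x * ln (pmf Q x) - pmf P x * ln (pmf P x) < pmf Q x - pmf P x"
proof -
  have strict: "pmf P x * ln (pmf Q x) - pmf P x * ln (pmf P x) < pmf Q x - pmf P x"
    if ne: "pmf P x \<noteq> pmf Q x"
  proof (cases "pmf P x = 0")
    case True
    with ne show ?thesis
      using pmf_nonneg[of Q x] by simp
  next
    case False
    then have p: "pmf P x > 0"
      by (simp add: pmf_pos set_pmf_iff)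
    from False assms have q: "pmf Q x > 0"
      by (metis pmf_positive set_pmf_iff subsetD)
    have "ln (pmf Q x / pmf P x) \<noteq> pmf Q x / pmf P x - 1"
      using ln_eq_minus_one[of "pmf Q x / pmf P x"] p q ne by auto
    moreover have "ln (pmf Q x / pmf P x) \<le> pmf Q x / pmf P x - 1"
      using p q by (intro ln_le_minus_one) simp
    ultimately have "ln (pmf Q x / pmf P x) < pmf Q x / pmf P x - 1"
      by simp
    then have "pmf P x * ln (pmf Q x / pmf P x) < pmf P x * (pmf Q x / pmf P x - 1)"
      using p by simp
    then show ?thesis
      using p q by (simp add: ln_div right_diff_distrib)
  qed
  then show "pmf P x \<noteq> pmf Q x \<Longrightarrow>
      pmf P x * ln (pmf Q x) - pmf P x * ln (pmf P x) < pmf Q x - pmf P x" .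
  show "pmf P x * ln (pmf Q x) - pmf P x * ln (pmf P x) \<le> pmf Q x - pmf P x"
    using strict by (cases "pmf P x = pmf Q x") auto
qed

text \<open>Gibbs' inequality, by summing the pointwise bounds: the differences
  \<open>pmf Q G - pmf P G\<close> add up to 0, and one point where the masses differ makes the sum
  strict.\<close>

lemma shannon_entropy_less_cross_entropy:
  assumes fin: "finite \<G>" and Q: "set_pmf Q \<subseteq> \<G>" and PQ: "set_pmf P \<subseteq> set_pmf Q"
    and ne: "P \<noteq> Q"
  shows "shannon_entropy \<G> P < - (\<Sum>G\<in>\<G>. pmf P G * ln (pmf Q G))"
proof -
  from ne obtain x where x: "pmf P x \<noteq> pmf Q x"
    by (meson pmf_eqI)
  then have xG: "x \<in> \<G>"
    using Q PQ by (metis set_pmf_iff subsetD)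
  have "(\<Sum>G\<in>\<G>. pmf P G * ln (pmf Q G) - pmf P G * ln (pmf P G)) < (\<Sum>G\<in>\<G>. pmf Q G - pmf P G)"
    using fin xG x pmf_ln_diff_le[OF PQ] by (intro sum_strict_mono_ex1) auto
  also have "\<dots> = 0"
    using sum_pmf_eq_1[OF fin Q] sum_pmf_eq_1[OF fin subset_trans[OF PQ Q]]
    by (simp add: sum_subtractf)
  finally show ?thesis
    by (simp add: shannon_entropy_def sum_subtractf)
qed

text \<open>A maximality test without Lagrange multipliers: if the cross entropy with
  \<open>Q\<close> is the same for all admissible \<open>P\<close>, Gibbs' inequality puts every
  other entropy strictly below that of \<open>Q\<close>. Strictness supplies the uniqueness that
  \<open>THE\<close> demands.\<close>

lemma canonical_eqI:
  assumes fin: "finite \<G>" and Q: "satisfies_on_average \<G> I C c Q"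
    and supp: "\<And>P. satisfies_on_average \<G> I C c P \<Longrightarrow> set_pmf P \<subseteq> set_pmf Q"
    and cross: "\<And>P. satisfies_on_average \<G> I C c P \<Longrightarrow>
      (\<Sum>G\<in>\<G>. pmf P G * ln (pmf Q G)) = (\<Sum>G\<in>\<G>. pmf Q G * ln (pmf Q G))"
  shows "canonical \<G> I C c = Q"
proof -
  have less: "shannon_entropy \<G> P < shannon_entropy \<G> Q"
    if "satisfies_on_average \<G> I C c P" "P \<noteq> Q" for P
  proof -
    have "set_pmf Q \<subseteq> \<G>"
      using Q by (simp add: satisfies_on_average_def)
    from shannon_entropy_less_cross_entropy[OF fin this supp[OF that(1)] that(2)]
    show ?thesis
      using cross[OF that(1)] by (simp add: shannon_entropy_def)
  qed
  show ?thesis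
    unfolding canonical_def
  proof (rule the_equality)
    show "is_arg_max (shannon_entropy \<G>) (satisfies_on_average \<G> I C c) Q"
      unfolding is_arg_max_def using Q less by (metis less_asym less_irrefl)
    show "P = Q" if "is_arg_max (shannon_entropy \<G>) (satisfies_on_average \<G> I C c) P" for P
      using that Q less unfolding is_arg_max_def by blast
  qed
qed

section \<open>Sums over bi-partite graphs\<close>

lemma sum_Pow_card:
  fixes \<phi> :: "nat \<Rightarrow> real"
  assumes "finite B"
  shows "(\<Sum>A\<in>Pow B. \<phi> (card A)) = (\<Sum>d\<le>card B. real (card B choose d) * \<phi> d)"
proof -
  have "(\<Sum>A\<in>Pow B. \<phi> (card A)) = (\<Sum>d\<le>card B. \<Sum>A | A \<in> Pow B \<and> card A = d. \<phi> (card A))"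
    using assms by (subst sum.group) (auto intro: card_mono)
  also have "\<dots> = (\<Sum>d\<le>card B. real (card B choose d) * \<phi> d)"
    using assms by (intro sum.cong refl) (simp add: n_subsets)
  finally show ?thesis .
qed

lemma finite_bipartite_graphs:
  assumes "finite L1" "finite L2"
  shows "finite (bipartite_graphs L1 L2)"
proof (rule finite_subset)
  show "bipartite_graphs L1 L2 \<subseteq> Pow (Pow (L1 \<union> L2))"
    by (auto simp: bipartite_graphs_def simple_graphs_def)
qed (use assms in simp)

lemma top_degree_eq_card:
  assumes "finite L2"
  shows "top_degree L2 G i = card {j \<in> L2. {i, j} \<in> G}"
  using assms by (simp add: top_degree_def adj_def Int_def)

lemma top_degree_le:
  assumes "finite L2"
  shows "top_degree L2 G i \<le> card L2"
  using assms by (auto simp: top_degree_eq_card intro: card_mono)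

lemma bipartite_graphs_iff:
  assumes "L1 \<inter> L2 = {}"
  shows "G \<in> bipartite_graphs L1 L2 \<longleftrightarrow> (\<forall>e\<in>G. \<exists>i\<in>L1. \<exists>j\<in>L2. e = {i, j})"
proof (intro iffI ballI)
  fix e assume G: "G \<in> bipartite_graphs L1 L2" and e: "e \<in> G"
  then obtain x y where xy: "e = {x, y}" "x \<noteq> y" "x \<in> L1 \<union> L2" "y \<in> L1 \<union> L2"
    by (auto simp: bipartite_graphs_def simple_graphs_def card_2_iff)
  with G e have "\<not> (x \<in> L1 \<and> y \<in> L1)" "\<not> (x \<in> L2 \<and> y \<in> L2)"
    by (auto simp: bipartite_graphs_def adj_def)
  with xy show "\<exists>i\<in>L1. \<exists>j\<in>L2. e = {i, j}"
    by (metis Un_iff insert_commute)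
next
  assume *: "\<forall>e\<in>G. \<exists>i\<in>L1. \<exists>j\<in>L2. e = {i, j}"
  have "e \<subseteq> L1 \<union> L2 \<and> card e = 2" if "e \<in> G" for e
    using * that assms by (fastforce simp: card_2_iff)
  moreover have "{i, j} \<notin> G" if "i \<in> L1 \<and> j \<in> L1 \<or> i \<in> L2 \<and> j \<in> L2" for i j
    using * that assms by (fastforce simp: doubleton_eq_iff)
  ultimately show "G \<in> bipartite_graphs L1 L2"
    by (auto simp: bipartite_graphs_def simple_graphs_def adj_def)
qed

text \<open>A bi-partite graph is the same as an independent choice of a neighbourhood in \<open>L2\<close> for every
  node of \<open>L1\<close>.\<close>

lemma sum_bipartite_graphs_prod:
  fixes \<phi> :: "'v \<Rightarrow> nat \<Rightarrow> real"
  assumes fin: "finite L1" "finite L2" and disj: "L1 \<inter> L2 = {}"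
  shows "(\<Sum>G\<in>bipartite_graphs L1 L2. \<Prod>i\<in>L1. \<phi> i (top_degree L2 G i)) =
    (\<Prod>i\<in>L1. \<Sum>d\<le>card L2. real (card L2 choose d) * \<phi> i d)"
proof -
  define enc where "enc G = (\<lambda>i\<in>L1. {j \<in> L2. {i, j} \<in> G})" for G
  define dec where "dec F = {{i, j} | i j. i \<in> L1 \<and> j \<in> F i}" for F
  \<comment> \<open>As the layers are disjoint, an unordered pair reveals which endpoint lies in
    \<open>L1\<close>, so \<open>F\<close> can be read off from \<open>dec F\<close>.\<close>
  have dec_iff: "{i, j} \<in> dec F \<longleftrightarrow> j \<in> F i"
    if "F \<in> L1 \<rightarrow>\<^sub>E Pow L2" "i \<in> L1" "j \<in> L2" for F i j
    using that disj unfolding dec_def by (auto simp: doubleton_eq_iff)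
  have "(\<Sum>G\<in>bipartite_graphs L1 L2. \<Prod>i\<in>L1. \<phi> i (top_degree L2 G i)) =
      (\<Sum>F\<in>L1 \<rightarrow>\<^sub>E Pow L2. \<Prod>i\<in>L1. \<phi> i (card (F i)))"
  proof (rule sum.reindex_bij_witness[where i = dec and j = enc])
    show "dec (enc G) = G" if "G \<in> bipartite_graphs L1 L2" for G
      using that unfolding bipartite_graphs_iff[OF disj] dec_def enc_def by fastforce
    show "enc G \<in> L1 \<rightarrow>\<^sub>E Pow L2" for G
      by (auto simp: enc_def)
    show "dec F \<in> bipartite_graphs L1 L2" if "F \<in> L1 \<rightarrow>\<^sub>E Pow L2" for F
      using that unfolding bipartite_graphs_iff[OF disj] dec_def by blast
    show "enc (dec F) = F" if F: "F \<in> L1 \<rightarrow>\<^sub>E Pow L2" for F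
    proof
      fix i
      have "F i \<subseteq> L2" if "i \<in> L1"
        using F that by auto
      moreover have "F i = undefined" if "i \<notin> L1"
        using F that by auto
      ultimately show "enc (dec F) i = F i"
        using dec_iff[OF F] by (auto simp: enc_def)
    qed
    show "(\<Prod>i\<in>L1. \<phi> i (card (enc G i))) = (\<Prod>i\<in>L1. \<phi> i (top_degree L2 G i))" for G
      using fin by (intro prod.cong) (simp_all add: enc_def top_degree_eq_card)
  qed
  also have "\<dots> = (\<Prod>i\<in>L1. \<Sum>A\<in>Pow L2. \<phi> i (card A))"
    using fin by (subst prod_sum_PiE) simp_all
  also have "\<dots> = (\<Prod>i\<in>L1. \<Sum>d\<le>card L2. real (card L2 choose d) * \<phi> i d)"
    using fin by (simp add: sum_Pow_card)
  finally show ?thesis .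
qed

section \<open>The canonical ensemble as a product distribution\<close>

locale top_degree_ensemble =
  fixes L1 L2 :: "'v set" and k :: "'v \<Rightarrow> nat"
  assumes fin: "finite L1" "finite L2" and disj: "L1 \<inter> L2 = {}"
    and k_le: "\<And>i. i \<in> L1 \<Longrightarrow> k i \<le> card L2"
begin

text \<open>The parameter \<open>p i\<close> is the density of the \<open>i\<close>-th row of the adjacency matrix; for empty
  \<open>L2\<close> it is \<open>0 / 0 = 0\<close>, which is harmless.\<close>

definition p :: "'v \<Rightarrow> real" where
  "p i = real (k i) / real (card L2)"

text \<open>The probability of one particular neighbourhood with \<open>d\<close> elements; the
  factor \<open>card L2 choose d\<close> for the degree itself enters only by summation over
  graphs.\<close>

definition row_weight :: "'v \<Rightarrow> nat \<Rightarrow> real" where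
  "row_weight i d = p i ^ d * (1 - p i) ^ (card L2 - d)"

definition weight :: "'v graph \<Rightarrow> real" where
  "weight G = (\<Prod>i\<in>L1. row_weight i (top_degree L2 G i))"

definition product_pmf :: "'v graph pmf" where
  "product_pmf = embed_pmf (\<lambda>G. if G \<in> bipartite_graphs L1 L2 then weight G else 0)"

lemma p_bounds:
  assumes "i \<in> L1"
  shows "0 \<le> p i" "p i \<le> 1"
  using k_le[OF assms] by (auto simp: p_def divide_le_eq)

lemma row_weight_nonneg: "i \<in> L1 \<Longrightarrow> 0 \<le> row_weight i d"
  using p_bounds by (simp add: row_weight_def)

lemma weight_nonneg: "0 \<le> weight G"
  unfolding weight_def by (intro prod_nonneg) (simp add: row_weight_nonneg)

text \<open>The degree of a node is binomially distributed, so the Bernstein identities for total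
  mass and mean apply in \<open>sum_weight\<close> and \<open>sum_weight_top_degree\<close>.\<close>

lemma Bernstein_eq_row_weight:
  "Bernstein (card L2) d (p i) = real (card L2 choose d) * row_weight i d"
  by (simp add: Bernstein_def row_weight_def)

lemma sum_weight: "(\<Sum>G\<in>bipartite_graphs L1 L2. weight G) = 1"
  unfolding weight_def sum_bipartite_graphs_prod[OF fin disj]
  by (simp flip: Bernstein_eq_row_weight)

text \<open>Absorbing the degree of \<open>i\<close> into the \<open>i\<close>-th factor keeps the
  product form, so the sum factorises: row \<open>i\<close> contributes the binomial mean
  \<open>card L2 * p i\<close> and every other row 1.\<close>

lemma sum_weight_top_degree:
  assumes i: "i \<in> L1"
  shows "(\<Sum>G\<in>bipartite_graphs L1 L2. weight G * real (top_degree L2 G i)) = real (k i)"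
proof -
  let ?\<phi> = "\<lambda>j d. row_weight j d * (if j = i then real d else 1)"
  have "(\<Sum>G\<in>bipartite_graphs L1 L2. weight G * real (top_degree L2 G i)) =
      (\<Sum>G\<in>bipartite_graphs L1 L2. \<Prod>j\<in>L1. ?\<phi> j (top_degree L2 G j))"
    using fin i by (simp add: weight_def prod.distrib prod.delta)
  also have "\<dots> = (\<Prod>j\<in>L1. \<Sum>d\<le>card L2. real (card L2 choose d) * ?\<phi> j d)"
    by (rule sum_bipartite_graphs_prod[OF fin disj])
  also have "\<dots> = (\<Prod>j\<in>L1. if j = i then real (card L2) * p i else 1)"
  proof (rule prod.cong[OF refl])
    fix j
    show "(\<Sum>d\<le>card L2. real (card L2 choose d) * ?\<phi> j d) =
        (if j = i then real (card L2) * p i else 1)"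
      using sum_k_Bernstein[of "card L2" "p i"] sum_Bernstein[of "card L2" "p j"]
      by (simp add: Bernstein_eq_row_weight mult_ac)
  qed
  \<comment> \<open>If \<open>L2\<close> is empty, \<open>k_le\<close> forces
    \<open>k i = 0\<close>, in agreement with \<open>p i = 0\<close>.\<close>
  also have "\<dots> = real (k i)"
    using fin i k_le[OF i] by (cases "card L2 = 0") (simp_all add: p_def prod.delta)
  finally show ?thesis .
qed

lemma pmf_product_pmf:
  "pmf product_pmf G = (if G \<in> bipartite_graphs L1 L2 then weight G else 0)"
  unfolding product_pmf_def
proof (rule pmf_embed_pmf)
  let ?w = "\<lambda>G. if G \<in> bipartite_graphs L1 L2 then weight G else 0"
  have "(\<integral>\<^sup>+G. ennreal (?w G) \<partial>count_space UNIV) =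
      (\<Sum>G\<in>bipartite_graphs L1 L2. ennreal (?w G))"
    using finite_bipartite_graphs[OF fin] by (intro nn_integral_count_space') auto
  also have "\<dots> = ennreal (\<Sum>G\<in>bipartite_graphs L1 L2. weight G)"
    by (subst sum_ennreal) (auto simp: weight_nonneg)
  finally show "(\<integral>\<^sup>+G. ennreal (?w G) \<partial>count_space UNIV) = 1"
    by (simp add: sum_weight)
qed (simp add: weight_nonneg)

abbreviation "on_average \<equiv> satisfies_on_average (bipartite_graphs L1 L2) L1
  (\<lambda>G i. real (top_degree L2 G i)) (\<lambda>i. real (k i))"

lemma product_pmf_on_average: "on_average product_pmf"
proof -
  have "set_pmf product_pmf \<subseteq> bipartite_graphs L1 L2"
    by (auto simp: set_pmf_iff pmf_product_pmf split: if_splits)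
  then show ?thesis
    by (simp add: satisfies_on_average_def pmf_product_pmf sum_weight_top_degree)
qed

text \<open>A node whose prescribed degree is extremal has this degree almost surely under every
  admissible distribution, so that the factors \<open>p i\<close> and \<open>1 - p i\<close> that vanish never occur.\<close>

lemma degenerate_row:
  assumes P: "on_average P" and G: "G \<in> set_pmf P" and i: "i \<in> L1"
  shows "top_degree L2 G i = 0 \<or> 0 < p i" "top_degree L2 G i = card L2 \<or> p i < 1"
proof -
  let ?\<G> = "bipartite_graphs L1 L2"
  have sub: "set_pmf P \<subseteq> ?\<G>"
    and mean: "(\<Sum>G\<in>?\<G>. pmf P G * real (top_degree L2 G i)) = real (k i)"
    using P i by (auto simp: satisfies_on_average_def)
  note fG = finite_bipartite_graphs[OF fin]
  have G\<G>: "G \<in> ?\<G>" and pos: "0 < pmf P G"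
    using sub G by (auto intro: pmf_positive)
  show "top_degree L2 G i = 0 \<or> 0 < p i"
  proof (cases "k i = 0")
    case True
    with mean have "(\<Sum>G\<in>?\<G>. pmf P G * real (top_degree L2 G i)) = 0"
      by simp
    then have "\<forall>G\<in>?\<G>. pmf P G * real (top_degree L2 G i) = 0"
      by (subst (asm) sum_nonneg_eq_0_iff) (auto simp: fG)
    with G\<G> pos show ?thesis
      by auto
  next
    case False
    with k_le[OF i] show ?thesis
      by (simp add: p_def)
  qed
  show "top_degree L2 G i = card L2 \<or> p i < 1"
  proof (cases "k i = card L2")
    case True
    \<comment> \<open>The number of non-neighbours of \<open>i\<close> is nonnegative and has mean 0
      here, so it vanishes on the support of \<open>P\<close>.\<close>
    have "(\<Sum>G\<in>?\<G>. pmf P G * (real (card L2) - real (top_degree L2 G i))) =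
        real (card L2) * (\<Sum>G\<in>?\<G>. pmf P G) - real (k i)"
      by (simp add: right_diff_distrib sum_subtractf mean sum_distrib_left mult.commute)
    also have "\<dots> = 0"
      using sum_pmf_eq_1[OF fG sub] True by simp
    finally have "\<forall>G\<in>?\<G>. pmf P G * (real (card L2) - real (top_degree L2 G i)) = 0"
      by (subst (asm) sum_nonneg_eq_0_iff) (auto simp: fG top_degree_le fin)
    with G\<G> pos show ?thesis
      by auto
  next
    case False
    with k_le[OF i] show ?thesis
      by (simp add: p_def divide_less_eq)
  qed
qed

text \<open>On admissible supports the log weight is affine in the degrees, so its mean will depend
  on the prescribed degrees only. Rows with \<open>p i = 0\<close> or \<open>p i = 1\<close> fit in:
  by \<open>degenerate_row\<close> the logarithm of zero then has coefficient 0.\<close>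

lemma weight_pos_ln_weight:
  assumes P: "on_average P" and G: "G \<in> set_pmf P"
  shows "0 < weight G"
    and "ln (weight G) = (\<Sum>i\<in>L1. real (top_degree L2 G i) * ln (p i)
      + (real (card L2) - real (top_degree L2 G i)) * ln (1 - p i))"
proof -
  have pos: "0 < p i ^ top_degree L2 G i" "0 < (1 - p i) ^ (card L2 - top_degree L2 G i)"
    if "i \<in> L1" for i
    using degenerate_row[OF P G that] by auto
  then have rpos: "0 < row_weight i (top_degree L2 G i)" if "i \<in> L1" for i
    using that by (simp add: row_weight_def)
  then show "0 < weight G"
    unfolding weight_def by (intro prod_pos) simp
  have "ln (weight G) = (\<Sum>i\<in>L1. ln (row_weight i (top_degree L2 G i)))"
    unfolding weight_def using fin rpos by (subst ln_prod) (auto simp: less_imp_neq[symmetric])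
  also have "\<dots> = (\<Sum>i\<in>L1. real (top_degree L2 G i) * ln (p i)
      + (real (card L2) - real (top_degree L2 G i)) * ln (1 - p i))"
  proof (rule sum.cong[OF refl])
    fix i assume "i \<in> L1"
    from pos[OF this] degenerate_row[OF P G this] top_degree_le[OF fin(2), of G i]
    show "ln (row_weight i (top_degree L2 G i)) = real (top_degree L2 G i) * ln (p i)
        + (real (card L2) - real (top_degree L2 G i)) * ln (1 - p i)"
      unfolding row_weight_def by (subst ln_mult_pos) (auto simp: ln_realpow of_nat_diff)
  qed
  finally show "ln (weight G) = (\<Sum>i\<in>L1. real (top_degree L2 G i) * ln (p i)
      + (real (card L2) - real (top_degree L2 G i)) * ln (1 - p i))" .
qed

text \<open>Averaging the affine formula for \<open>ln (weight G)\<close> replaces each degree by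
  \<open>k i\<close>. The result no longer involves \<open>P\<close>, which is the cross entropy
  condition of \<open>canonical_eqI\<close>, as \<open>product_pmf\<close> is itself one of the
  admissible \<open>P\<close>.\<close>

lemma canonical_eq_product_pmf:
  "canonical (bipartite_graphs L1 L2) L1 (\<lambda>G i. real (top_degree L2 G i)) (\<lambda>i. real (k i)) =
    product_pmf"
proof (rule canonical_eqI)
  let ?\<G> = "bipartite_graphs L1 L2"
  note fG = finite_bipartite_graphs[OF fin]
  show "finite ?\<G>"
    by (rule fG)
  show "on_average product_pmf"
    by (rule product_pmf_on_average)
  show "set_pmf P \<subseteq> set_pmf product_pmf" if P: "on_average P" for P
  proof
    fix G assume G: "G \<in> set_pmf P"
    with P have "G \<in> ?\<G>"
      by (auto simp: satisfies_on_average_def)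
    with weight_pos_ln_weight(1)[OF P G] show "G \<in> set_pmf product_pmf"
      by (simp add: set_pmf_iff pmf_product_pmf)
  qed
  have cross: "(\<Sum>G\<in>?\<G>. pmf P G * ln (pmf product_pmf G)) =
      (\<Sum>i\<in>L1. real (k i) * ln (p i) + (real (card L2) - real (k i)) * ln (1 - p i))"
    if P: "on_average P" for P
  proof -
    have sub: "set_pmf P \<subseteq> ?\<G>"
      using P by (simp add: satisfies_on_average_def)
    have "(\<Sum>G\<in>?\<G>. pmf P G * ln (pmf product_pmf G)) =
        (\<Sum>G\<in>?\<G>. pmf P G * (\<Sum>i\<in>L1. real (top_degree L2 G i) * ln (p i)
          + (real (card L2) - real (top_degree L2 G i)) * ln (1 - p i)))"
    proof (rule sum.cong[OF refl])
      fix G assume "G \<in> ?\<G>"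
      then show "pmf P G * ln (pmf product_pmf G) =
          pmf P G * (\<Sum>i\<in>L1. real (top_degree L2 G i) * ln (p i)
            + (real (card L2) - real (top_degree L2 G i)) * ln (1 - p i))"
        using weight_pos_ln_weight(2)[OF P]
        by (cases "G \<in> set_pmf P") (simp_all add: pmf_product_pmf set_pmf_iff)
    qed
    also have "\<dots> = (\<Sum>i\<in>L1. \<Sum>G\<in>?\<G>. pmf P G * (real (top_degree L2 G i) * ln (p i)
          + (real (card L2) - real (top_degree L2 G i)) * ln (1 - p i)))"
      by (subst sum.swap) (simp add: sum_distrib_left)
    also have "\<dots> = (\<Sum>i\<in>L1. real (k i) * ln (p i) + (real (card L2) - real (k i)) * ln (1 - p i))"
    proof (rule sum.cong[OF refl])
      fix i assume "i \<in> L1"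
      with P have mean: "(\<Sum>G\<in>?\<G>. pmf P G * real (top_degree L2 G i)) = real (k i)"
        by (simp add: satisfies_on_average_def)
      have "(\<Sum>G\<in>?\<G>. pmf P G * (real (top_degree L2 G i) * ln (p i)
          + (real (card L2) - real (top_degree L2 G i)) * ln (1 - p i))) =
        (\<Sum>G\<in>?\<G>. pmf P G * real (top_degree L2 G i)) * ln (p i)
          + (real (card L2) * (\<Sum>G\<in>?\<G>. pmf P G)
              - (\<Sum>G\<in>?\<G>. pmf P G * real (top_degree L2 G i))) * ln (1 - p i)"
        by (simp add: sum_distrib_left sum_distrib_right algebra_simps sum.distrib sum_subtractf)
      then show "(\<Sum>G\<in>?\<G>. pmf P G * (real (top_degree L2 G i) * ln (p i)
          + (real (card L2) - real (top_degree L2 G i)) * ln (1 - p i))) =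
        real (k i) * ln (p i) + (real (card L2) - real (k i)) * ln (1 - p i)"
        by (simp add: mean sum_pmf_eq_1[OF fG sub])
    qed
    finally show ?thesis .
  qed
  show "(\<Sum>G\<in>?\<G>. pmf P G * ln (pmf product_pmf G)) =
      (\<Sum>G\<in>?\<G>. pmf product_pmf G * ln (pmf product_pmf G))" if "on_average P" for P
    using cross[OF that] cross[OF product_pmf_on_average] by simp
qed

section \<open>The relative entropy as a sum over the top layer\<close>

lemma gm_weight_eq_row_weight:
  assumes "i \<in> L1"
  shows "gm_weight (card L2) (k i) = - ln (real (card L2 choose k i) * row_weight i (k i))"
\<comment> \<open>For empty \<open>L2\<close> the bases \<open>(card L2 - k i) / card L2\<close> and
  \<open>1 - p i\<close> differ, being 0 and 1, but they occur with exponent 0.\<close>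
proof (cases "card L2 = 0")
  case False
  with k_le[OF assms] have "real (card L2 - k i) / real (card L2) = 1 - p i"
    by (simp add: p_def of_nat_diff diff_divide_distrib)
  with k_le[OF assms] show ?thesis
    by (simp add: gm_weight_def row_weight_def p_def mult.assoc)
qed (use k_le[OF assms] in \<open>simp add: gm_weight_def row_weight_def\<close>)

lemma row_weight_k_pos:
  assumes "i \<in> L1"
  shows "0 < row_weight i (k i)"
proof -
  have "k i = 0 \<or> 0 < p i"
    using k_le[OF assms] by (cases "k i = 0") (simp_all add: p_def)
  moreover have "k i = card L2 \<or> p i < 1"
    using k_le[OF assms] by (auto simp: p_def divide_less_eq)
  ultimately show ?thesis
    by (auto simp: row_weight_def)
qed

text \<open>The condition on all rows is a product of row indicators, so the count falls under
  \<open>sum_bipartite_graphs_prod\<close>.\<close>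

lemma card_prescribed_degrees:
  "real (card {G \<in> bipartite_graphs L1 L2. \<forall>i\<in>L1. top_degree L2 G i = k i}) =
    (\<Prod>i\<in>L1. real (card L2 choose k i))"
proof -
  have "real (card {G \<in> bipartite_graphs L1 L2. \<forall>i\<in>L1. top_degree L2 G i = k i}) =
      (\<Sum>G\<in>bipartite_graphs L1 L2. of_bool (\<forall>i\<in>L1. top_degree L2 G i = k i))"
    using finite_bipartite_graphs[OF fin] by (simp add: Int_def)
  also have "\<dots> = (\<Sum>G\<in>bipartite_graphs L1 L2. \<Prod>i\<in>L1. of_bool (top_degree L2 G i = k i))"
    using fin by (intro sum.cong refl) (auto simp: of_bool_def prod_zero_iff)
  also have "\<dots> = (\<Prod>i\<in>L1. \<Sum>d\<le>card L2. real (card L2 choose d) * of_bool (d = k i))"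
    by (rule sum_bipartite_graphs_prod[OF fin disj])
  also have "\<dots> = (\<Prod>i\<in>L1. real (card L2 choose k i))"
    using k_le by (intro prod.cong refl) (simp add: of_bool_def if_distrib sum.delta cong: if_cong)
  finally show ?thesis .
qed

lemma relative_entropy_eq:
  "top_degree_relative_entropy L1 L2 k = (\<Sum>i\<in>L1. gm_weight (card L2) (k i))"
proof -
  let ?\<G> = "bipartite_graphs L1 L2"
  define S where "S = {G \<in> ?\<G>. \<forall>i\<in>L1. top_degree L2 G i = k i}"
  define q where "q = (\<Prod>i\<in>L1. row_weight i (k i))"
  have q: "0 < q"
    unfolding q_def using row_weight_k_pos by (intro prod_pos) simp
  have cS: "real (card S) = (\<Prod>i\<in>L1. real (card L2 choose k i))"
    unfolding S_def by (rule card_prescribed_degrees)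
  \<comment> \<open>Positive binomial coefficients show that \<open>S\<close> is nonempty, as
    \<open>pmf_of_set S\<close> requires.\<close>
  have "0 < (\<Prod>i\<in>L1. real (card L2 choose k i))"
    using k_le by (intro prod_pos) simp
  with cS have c: "0 < card S"
    by simp
  then have S: "finite S" "S \<noteq> {}"
    by (auto simp: card_gt_0_iff)
  have "top_degree_relative_entropy L1 L2 k =
      (\<Sum>G\<in>?\<G>. pmf (pmf_of_set S) G * ln (pmf (pmf_of_set S) G / pmf product_pmf G))"
    by (simp add: top_degree_relative_entropy_def relative_entropy_def microcanonical_def
        canonical_eq_product_pmf S_def Let_def)
  also have "\<dots> = (\<Sum>G\<in>S. pmf (pmf_of_set S) G * ln (pmf (pmf_of_set S) G / pmf product_pmf G))"
    using finite_bipartite_graphs[OF fin] S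
    by (intro sum.mono_neutral_right) (auto simp: S_def)
  also have "\<dots> = (\<Sum>G\<in>S. 1 / real (card S) * ln (1 / real (card S) / q))"
  proof (rule sum.cong[OF refl])
    fix G assume G: "G \<in> S"
    then have "pmf product_pmf G = q"
      by (auto simp: S_def q_def pmf_product_pmf weight_def intro!: prod.cong)
    with G S show "pmf (pmf_of_set S) G * ln (pmf (pmf_of_set S) G / pmf product_pmf G) =
        1 / real (card S) * ln (1 / real (card S) / q)"
      by simp
  qed
  also have "\<dots> = - ln (real (card S) * q)"
    using c q by (simp add: ln_div ln_mult_pos)
  also have "real (card S) * q = (\<Prod>i\<in>L1. real (card L2 choose k i) * row_weight i (k i))"
    by (simp add: cS q_def prod.distrib)
  also have "- ln \<dots> = (\<Sum>i\<in>L1. gm_weight (card L2) (k i))"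
  proof (subst ln_prod)
    show "real (card L2 choose k i) * row_weight i (k i) \<noteq> 0" if "i \<in> L1" for i
      using row_weight_k_pos[OF that] k_le[OF that] by simp
  qed (use fin in \<open>simp_all add: gm_weight_eq_row_weight sum_negf\<close>)
  finally show ?thesis .
qed

end

section \<open>The weights \<open>g_weight\<close> and \<open>gm_weight\<close>\<close>

lemma g_weight_eq_ln_fact:
  "g_weight k = ln (fact k) - ln (real k ^ k) + real k"
proof -
  have "0 < real k ^ k"
    by (cases k) auto
  then show ?thesis
    by (simp add: g_weight_def ln_div ln_mult_pos)
qed

text \<open>The factorial contributes \<open>ln (k + 1)\<close>, which reduces
  \<open>(k + 1) * ln (k + 1)\<close> to \<open>k * ln (k + 1)\<close>. Monotonicity and the limit
  of the increments are read off this form; at \<open>k = 0\<close> it gives the correct increment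
  1.\<close>

lemma g_weight_Suc: "g_weight (Suc k) = g_weight k + (1 - real k * ln (1 + 1 / real k))"
proof (cases "k = 0")
  case True
  then show ?thesis
    by (simp add: g_weight_eq_ln_fact)
next
  case False
  have "1 + 1 / real k = real (Suc k) / real k"
    using False by (simp add: field_simps)
  then have "ln (1 + 1 / real k) = ln (real (Suc k)) - ln (real k)"
    using False by (simp only:) (subst ln_div, auto)
  moreover have "ln (fact (Suc k) :: real) = ln (real (Suc k)) + ln (fact k)"
    by (simp add: ln_mult_pos del: of_nat_Suc)
  moreover have "ln (real (Suc k) ^ Suc k) = real (Suc k) * ln (real (Suc k))"
      "ln (real k ^ k) = real k * ln (real k)"
    using False by (simp_all add: ln_realpow del: of_nat_Suc power_Suc)
  ultimately show ?thesis
    by (simp only: g_weight_eq_ln_fact) (simp add: algebra_simps)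
qed

lemma g_weight_Suc_le: "g_weight k \<le> g_weight (Suc k)"
proof (cases "k = 0")
  case False
  have "real k * ln (1 + 1 / real k) \<le> real k * (1 / real k)"
    by (intro mult_left_mono ln_add_one_self_le_self) auto
  with False show ?thesis
    by (simp add: g_weight_Suc)
qed (simp add: g_weight_Suc)

lemma g_weight_mono: "k \<le> l \<Longrightarrow> g_weight k \<le> g_weight l"
  by (rule lift_Suc_mono_le[of g_weight, OF g_weight_Suc_le])

lemma g_weight_0 [simp]: "g_weight 0 = 0"
  by (simp add: g_weight_def)

lemma g_weight_nonneg: "0 \<le> g_weight k"
  using g_weight_mono[of 0 k] by simp

text \<open>Each \<open>g_weight l\<close> is the logarithm of \<open>fact l / l ^ l\<close> plus
  the linear term \<open>l\<close>. The linear terms cancel because \<open>k + (m - k) = m\<close>,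
  and the rest is minus the logarithm of the binomial probability.\<close>

lemma gm_weight_eq:
  assumes "k \<le> m"
  shows "gm_weight m k = g_weight k + g_weight (m - k) - g_weight m"
proof -
  have pos: "0 < real l ^ l" for l
    by (cases l) auto
  have b: "real (m choose k) = fact m / (fact k * fact (m - k))"
    using assms by (simp add: binomial_fact)
  have "real m ^ m = real m ^ k * real m ^ (m - k)"
    using assms by (simp flip: power_add)
  then have "real (m choose k) * (real k / real m) ^ k * (real (m - k) / real m) ^ (m - k) =
      fact m / (fact k * fact (m - k)) * (real k ^ k * real (m - k) ^ (m - k) / real m ^ m)"
    by (simp add: b power_divide del: of_nat_diff)
  also have "ln \<dots> = g_weight m - g_weight k - g_weight (m - k)"
    using assms pos[of k] pos[of m] pos[of "m - k"]
    by (simp add: ln_mult_pos ln_div g_weight_eq_ln_fact)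
  finally show ?thesis
    using assms by (simp add: gm_weight_def)
qed

lemma gm_weight_le_g_weight: "gm_weight m k \<le> g_weight k"
  using g_weight_nonneg[of k] g_weight_mono[of "m - k" m]
  by (cases "k \<le> m") (simp_all add: gm_weight_eq, simp add: gm_weight_def)

text \<open>A binomial probability is a single term of a sum of nonnegative terms with total 1,
  hence at most 1.\<close>

lemma gm_weight_nonneg: "0 \<le> gm_weight m k"
proof (cases "k \<le> m")
  case True
  have eq: "real (m choose k) * (real k / real m) ^ k * (real (m - k) / real m) ^ (m - k) =
      Bernstein m k (real k / real m)"
    using True by (cases "m = 0") (simp_all add: Bernstein_def of_nat_diff diff_divide_distrib)
  have nonneg: "0 \<le> Bernstein m j (real k / real m)" for j
    using True by (intro Bernstein_nonneg) (auto simp: divide_le_eq)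
  have "Bernstein m k (real k / real m) \<le> (\<Sum>j\<le>m. Bernstein m j (real k / real m))"
    using True nonneg by (intro member_le_sum) auto
  then have "ln (Bernstein m k (real k / real m)) \<le> 0"
    using nonneg[of k] by (cases "Bernstein m k (real k / real m) = 0") auto
  then show ?thesis
    using True by (simp only: gm_weight_def eq) simp
qed (simp add: gm_weight_def)

text \<open>Telescoping into \<open>k\<close> increments, each of which tends to 0 because
  \<open>m * ln (1 + 1 / m)\<close> tends to 1.\<close>

lemma g_weight_shift_tendsto: "(\<lambda>m. g_weight (m + k) - g_weight m) \<longlonglongrightarrow> 0"
proof (induction k)
  case (Suc k)
  have "(\<lambda>m. 1 - real m * ln (1 + 1 / real m)) \<longlonglongrightarrow> 0"
    by real_asymp
  then have "(\<lambda>m. 1 - real (m + k) * ln (1 + 1 / real (m + k))) \<longlonglongrightarrow> 0"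
    by (rule LIMSEQ_ignore_initial_segment)
  from tendsto_add[OF Suc this] show ?case
    by (simp add: g_weight_Suc algebra_simps)
qed simp

lemma gm_weight_tendsto: "(\<lambda>m. gm_weight m k) \<longlonglongrightarrow> g_weight k"
\<comment> \<open>Passing to \<open>m + k\<close> secures the hypothesis of
  \<open>gm_weight_eq\<close>.\<close>
proof (rule LIMSEQ_offset[where k = k])
  have "(\<lambda>m. g_weight k - (g_weight (m + k) - g_weight m)) \<longlonglongrightarrow> g_weight k - 0"
    by (intro tendsto_intros g_weight_shift_tendsto)
  then show "(\<lambda>m. gm_weight (m + k) k) \<longlonglongrightarrow> g_weight k"
    by (simp add: gm_weight_eq algebra_simps)
qed

section \<open>Averages over the empirical degree distribution\<close>

text \<open>Every node contributes its weight at the single degree \<open>d = k i\<close>, so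
  averages over nodes become pairings with the empirical distribution.\<close>

lemma empirical_degree_distribution_sums:
  fixes w :: "nat \<Rightarrow> real"
  shows "(\<lambda>d. empirical_degree_distribution L k d * w d) sums
    ((\<Sum>i\<in>L. w (k i)) / real (card L))"
proof -
  have "(\<lambda>d. (\<Sum>i\<in>L. if d = k i then w d else 0) / real (card L)) sums
      ((\<Sum>i\<in>L. w (k i)) / real (card L))"
    by (intro sums_divide sums_sum sums_single)
  moreover have "(\<Sum>i\<in>L. if d = k i then w d else 0) / real (card L) =
      empirical_degree_distribution L k d * w d" for d
    by (auto simp: empirical_degree_distribution_def sum_distrib_right indicator_def
        intro!: sum.cong)
  ultimately show ?thesis
    by simp
qed

lemma l1_norm_eq_suminf:
  assumes "summable (\<lambda>d. \<bar>h d\<bar> * w d)"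
  shows "l1_norm w h = ereal (\<Sum>d. \<bar>h d\<bar> * w d)"
  unfolding l1_norm_def using assms by (rule suminf_ereal')

lemma summable_of_l1_norm_less:
  assumes "\<And>d. 0 \<le> w d" "l1_norm w h < ereal B"
  shows "summable (\<lambda>d. \<bar>h d\<bar> * w d)"
  using assms unfolding l1_norm_def by (intro summable_ereal) auto

text \<open>The error splits into the pairing of \<open>W n\<close> with the empirical distribution
  minus \<open>f\<close>, bounded by the \<open>w\<close>-norm because \<open>W n \<le> w\<close>,
  and the pairing of \<open>f\<close> with \<open>W n - w'\<close>, handled by dominated
  convergence. Letting \<open>W\<close> vary with \<open>n\<close> covers both fixed and growing
  bottom layers.\<close>

lemma average_weight_tendsto:
  fixes L :: "nat \<Rightarrow> 'v set" and k :: "nat \<Rightarrow> 'v \<Rightarrow> nat" and f :: "nat pmf"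
    and W :: "nat \<Rightarrow> nat \<Rightarrow> real" and w w' :: "nat \<Rightarrow> real"
  assumes conv: "(\<lambda>n. l1_norm w (\<lambda>d. empirical_degree_distribution (L n) (k n) d - pmf f d))
      \<longlonglongrightarrow> 0"
    and W_nonneg: "\<And>n d. 0 \<le> W n d" and W_le: "\<And>n d. W n d \<le> w d"
    and W_lim: "\<And>d. (\<lambda>n. W n d) \<longlonglongrightarrow> w' d"
  shows "(\<lambda>n. (\<Sum>i\<in>L n. W n (k n i)) / real (card (L n))) \<longlonglongrightarrow> (\<Sum>d. pmf f d * w' d)"
    and "summable (\<lambda>d. pmf f d * w' d)"
proof -
  let ?h = "\<lambda>n. empirical_degree_distribution (L n) (k n)"
  let ?a = "\<lambda>n d. \<bar>?h n d - pmf f d\<bar> * w d"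
  have w_nonneg: "0 \<le> w d" for d
    using W_nonneg W_le order_trans by blast
  \<comment> \<open>The extended norm may be infinite for some \<open>n\<close>; once it is below 1,
    it is the value of a convergent real series.\<close>
  have ev: "\<forall>\<^sub>F n in sequentially. l1_norm w (\<lambda>d. ?h n d - pmf f d) < ereal 1"
    using order_tendstoD(2)[OF conv, of 1] by (simp add: one_ereal_def)
  then have sum_a: "\<forall>\<^sub>F n in sequentially. summable (?a n)"
    by eventually_elim (rule summable_of_l1_norm_less[OF w_nonneg])
  from sum_a have "\<forall>\<^sub>F n in sequentially.
      l1_norm w (\<lambda>d. ?h n d - pmf f d) = ereal (\<Sum>d. ?a n d)"
    by eventually_elim (rule l1_norm_eq_suminf)
  from Lim_transform_eventually[OF conv this] have a_lim: "(\<lambda>n. \<Sum>d. ?a n d) \<longlonglongrightarrow> 0"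
    by (simp add: zero_ereal_def)
  \<comment> \<open>One index suffices to make \<open>w\<close> summable against \<open>f\<close>:
    the empirical distribution has finite support, and \<open>f\<close> is at most this distribution
    plus the absolute difference.\<close>
  obtain N where N: "summable (?a N)"
    using sum_a by (auto simp: eventually_sequentially)
  have "summable (\<lambda>d. ?h N d * w d + ?a N d)"
    using N empirical_degree_distribution_sums[THEN sums_summable] by (rule summable_add[rotated])
  then have sum_fw: "summable (\<lambda>d. pmf f d * w d)"
  proof (rule summable_comparison_test'[where N = 0])
    fix d
    have "pmf f d \<le> ?h N d + \<bar>?h N d - pmf f d\<bar>"
      by linarith
    then have "pmf f d * w d \<le> (?h N d + \<bar>?h N d - pmf f d\<bar>) * w d"
      using w_nonneg by (rule mult_right_mono)
    then show "norm (pmf f d * w d) \<le> ?h N d * w d + ?a N d"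
      using w_nonneg[of d] by (simp add: algebra_simps abs_mult)
  qed
  have bound: "norm (pmf f d * W n d) \<le> pmf f d * w d" for n d
    using W_nonneg[of n d] W_le[of n d] by (simp add: abs_mult mult_left_mono)
  then have "\<forall>\<^sub>F (d, n) in at_top \<times>\<^sub>F sequentially. norm (pmf f d * W n d) \<le> pmf f d * w d"
    by (intro always_eventually) auto
  moreover have "(\<lambda>n. pmf f d * W n d) \<longlonglongrightarrow> pmf f d * w' d" for d
    by (intro tendsto_intros W_lim)
  ultimately have "(\<forall>\<^sub>F n in sequentially. summable (\<lambda>d. norm (pmf f d * W n d))) \<and>
      summable (\<lambda>d. norm (pmf f d * w' d)) \<and>
      (\<lambda>n. \<Sum>d. pmf f d * W n d) \<longlonglongrightarrow> (\<Sum>d. pmf f d * w' d)"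
    using sum_fw by (intro tannerys_theorem) auto
  then have fW: "(\<lambda>n. \<Sum>d. pmf f d * W n d) \<longlonglongrightarrow> (\<Sum>d. pmf f d * w' d)"
    and sum_fw': "summable (\<lambda>d. norm (pmf f d * w' d))"
    by blast+
  show "summable (\<lambda>d. pmf f d * w' d)"
    using sum_fw' by (rule summable_norm_cancel)
  have "\<forall>\<^sub>F n in sequentially. norm ((\<Sum>i\<in>L n. W n (k n i)) / real (card (L n))
      - (\<Sum>d. pmf f d * W n d)) \<le> (\<Sum>d. ?a n d)"
    using sum_a
  proof eventually_elim
    case (elim n)
    have fWn: "summable (\<lambda>d. pmf f d * W n d)"
      by (rule summable_comparison_test'[OF sum_fw, of 0]) (rule bound)
    note sums_diff[OF empirical_degree_distribution_sums[of "L n" "k n" "W n"]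
        summable_sums[OF fWn]]
    then have sums: "(\<lambda>d. (?h n d - pmf f d) * W n d) sums
        ((\<Sum>i\<in>L n. W n (k n i)) / real (card (L n)) - (\<Sum>d. pmf f d * W n d))"
      by (simp add: left_diff_distrib)
    have le: "norm ((?h n d - pmf f d) * W n d) \<le> ?a n d" for d
      using W_nonneg[of n d] W_le[of n d] by (simp add: abs_mult mult_left_mono)
    show ?case
      unfolding sums_unique[OF sums] by (rule norm_suminf_le[OF le elim])
  qed
  from tendsto_add[OF Lim_null_comparison[OF this a_lim] fW]
  show "(\<lambda>n. (\<Sum>i\<in>L n. W n (k n i)) / real (card (L n))) \<longlonglongrightarrow> (\<Sum>d. pmf f d * w' d)"
    by simp
qed

section \<open>The fraction of top nodes and the four regimes\<close>

lemma layer_fraction_tendsto: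
  fixes n1 n2 :: "nat \<Rightarrow> nat"
  assumes ratio: "(\<lambda>n. ereal (real (n2 n)) / ereal (real (n1 n))) \<longlonglongrightarrow> c"
    and pos: "\<forall>\<^sub>F n in sequentially. 0 < n1 n"
  shows "c = ereal r \<Longrightarrow> (\<lambda>n. real (n1 n) / real (n1 n + n2 n)) \<longlonglongrightarrow> 1 / (1 + r)"
    and "c = \<infinity> \<Longrightarrow> (\<lambda>n. real (n1 n) / real (n1 n + n2 n)) \<longlonglongrightarrow> 0"
proof -
  have "\<forall>\<^sub>F n in sequentially.
      ereal (real (n2 n)) / ereal (real (n1 n)) = ereal (real (n2 n) / real (n1 n))"
    using pos by eventually_elim simp
  from Lim_transform_eventually[OF ratio this]
  have r: "(\<lambda>n. ereal (real (n2 n) / real (n1 n))) \<longlonglongrightarrow> c" .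
  have eq: "\<forall>\<^sub>F n in sequentially.
      1 / (1 + real (n2 n) / real (n1 n)) = real (n1 n) / real (n1 n + n2 n)"
    using pos by eventually_elim (simp add: field_simps)
  show "(\<lambda>n. real (n1 n) / real (n1 n + n2 n)) \<longlonglongrightarrow> 1 / (1 + r)" if "c = ereal r"
  proof -
    have lim: "(\<lambda>n. real (n2 n) / real (n1 n)) \<longlonglongrightarrow> r"
      using r that by simp
    \<comment> \<open>Nonnegativity of the limit ratio ensures that \<open>1 + r\<close> is
      nonzero.\<close>
    then have "0 \<le> r"
      by (rule LIMSEQ_le_const) auto
    then have "(\<lambda>n. 1 / (1 + real (n2 n) / real (n1 n))) \<longlonglongrightarrow> 1 / (1 + r)"
      by (intro tendsto_intros lim) simp
    from Lim_transform_eventually[OF this eq] show ?thesis .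
  qed
  show "(\<lambda>n. real (n1 n) / real (n1 n + n2 n)) \<longlonglongrightarrow> 0" if "c = \<infinity>"
  proof -
    have "filterlim (\<lambda>n. real (n2 n) / real (n1 n)) at_top sequentially"
      using r that by (simp add: tendsto_PInfty_eq_at_top)
    then have "filterlim (\<lambda>n. 1 + real (n2 n) / real (n1 n)) at_top sequentially"
      by (rule filterlim_tendsto_add_at_top[OF tendsto_const])
    then have "(\<lambda>n. 1 / (1 + real (n2 n) / real (n1 n))) \<longlonglongrightarrow> 0"
      by (intro tendsto_divide_0[OF tendsto_const] filterlim_at_top_imp_at_infinity)
    from Lim_transform_eventually[OF this eq] show ?thesis .
  qed
qed

theorem theorem1p6:
  fixes n1 n2 :: "nat \<Rightarrow> nat"
    and \<Lambda>1 \<Lambda>2 :: "nat \<Rightarrow> 'v set"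
    and kstar :: "nat \<Rightarrow> 'v \<Rightarrow> nat"
    and f :: "nat pmf"
    and c :: ereal
    and s :: "nat \<Rightarrow> real"
  assumes sizes: "\<And>n. n1 n + n2 n = n"
    and layers: "\<And>n. finite (\<Lambda>1 n)" "\<And>n. finite (\<Lambda>2 n)" "\<And>n. \<Lambda>1 n \<inter> \<Lambda>2 n = {}"
      "\<And>n. card (\<Lambda>1 n) = n1 n" "\<And>n. card (\<Lambda>2 n) = n2 n"
    and realised: "\<And>n. \<exists>G\<in>bipartite_graphs (\<Lambda>1 n) (\<Lambda>2 n).
      \<forall>i\<in>\<Lambda>1 n. top_degree (\<Lambda>2 n) G i = kstar n i"
    and conv: "(\<lambda>n. l1_norm g_weight
      (\<lambda>k. empirical_degree_distribution (\<Lambda>1 n) (kstar n) k - pmf f k)) \<longlonglongrightarrow> 0"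
    and s_def: "\<And>n. s n =
      top_degree_relative_entropy (\<Lambda>1 n) (\<Lambda>2 n) (kstar n) / real (n1 n + n2 n)"
    and ratio: "(\<lambda>n. ereal (real (n2 n)) / ereal (real (n1 n))) \<longlonglongrightarrow> c"
  shows
    "(\<forall>m>0. (\<forall>\<^sub>F n in sequentially. n1 n = m) \<and> filterlim n2 at_top sequentially \<and> c = \<infinity>
        \<longrightarrow> s \<longlonglongrightarrow> 0)
     \<and> (filterlim n1 at_top sequentially \<and> filterlim n2 at_top sequentially \<and> c = \<infinity>
        \<longrightarrow> s \<longlonglongrightarrow> 0)
     \<and> (\<forall>m>0. filterlim n1 at_top sequentially \<and> (\<forall>\<^sub>F n in sequentially. n2 n = m) \<and> c = 0
        \<longrightarrow> (\<lambda>n. ereal (s n)) \<longlonglongrightarrow> l1_norm (gm_weight m) (pmf f))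
     \<and> (filterlim n1 at_top sequentially \<and> filterlim n2 at_top sequentially \<and> 0 \<le> c \<and> c < \<infinity>
        \<longrightarrow> (\<lambda>n. ereal (s n)) \<longlonglongrightarrow> 1 / (1 + c) * l1_norm g_weight (pmf f))"
proof -
  let ?x = "\<lambda>n. real (n1 n) / real (n1 n + n2 n)"
  define T where
    "T n = (\<Sum>i\<in>\<Lambda>1 n. gm_weight (n2 n) (kstar n i)) / real (card (\<Lambda>1 n))" for n
  \<comment> \<open>This also holds for \<open>n1 n = 0\<close>: the entropy is then an empty sum
    and both sides are 0.\<close>
  have s_eq: "s n = ?x n * T n" for n
  proof -
    have "kstar n i \<le> card (\<Lambda>2 n)" if "i \<in> \<Lambda>1 n" for i
      using realised[of n] that by (metis layers(2) top_degree_le)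
    then interpret top_degree_ensemble "\<Lambda>1 n" "\<Lambda>2 n" "kstar n"
      using layers by unfold_locales auto
    show ?thesis
      unfolding s_def relative_entropy_eq T_def layers(4,5)
      using layers(1)[of n] layers(4)[of n] by (cases "n1 n = 0") auto
  qed
  \<comment> \<open>Besides \<open>conv\<close>, this limit uses only that \<open>n2\<close> grows;
    the ratio \<open>c\<close> enters solely through the factor \<open>?x n\<close>.\<close>
  have T_g: "T \<longlonglongrightarrow> (\<Sum>d. pmf f d * g_weight d)"
    and norm_g: "l1_norm g_weight (pmf f) = ereal (\<Sum>d. pmf f d * g_weight d)"
    if n2: "filterlim n2 at_top sequentially"
  proof -
    note * = average_weight_tendsto[OF conv, where W = "\<lambda>n. gm_weight (n2 n)" and w' = g_weight,
        OF gm_weight_nonneg gm_weight_le_g_weight filterlim_compose[OF gm_weight_tendsto n2]]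
    from *(1) show "T \<longlonglongrightarrow> (\<Sum>d. pmf f d * g_weight d)"
      unfolding T_def .
    from *(2) show "l1_norm g_weight (pmf f) = ereal (\<Sum>d. pmf f d * g_weight d)"
      by (subst l1_norm_eq_suminf) simp_all
  qed
  \<comment> \<open>With \<open>n2\<close> eventually constant, the weights are eventually
    \<open>gm_weight m\<close>, which therefore appears in the limit; \<open>g_weight\<close>
    remains the dominating function.\<close>
  have T_gm: "T \<longlonglongrightarrow> (\<Sum>d. pmf f d * gm_weight m d)"
    and norm_gm: "l1_norm (gm_weight m) (pmf f) = ereal (\<Sum>d. pmf f d * gm_weight m d)"
    if n2: "\<forall>\<^sub>F n in sequentially. n2 n = m" for m
  proof -
    have "\<forall>\<^sub>F n in sequentially. gm_weight (n2 n) d = gm_weight m d" for d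
      using n2 by eventually_elim simp
    then have "(\<lambda>n. gm_weight (n2 n) d) \<longlonglongrightarrow> gm_weight m d" for d
      by (rule tendsto_eventually)
    note * = average_weight_tendsto[OF conv, where W = "\<lambda>n. gm_weight (n2 n)",
        OF gm_weight_nonneg gm_weight_le_g_weight this]
    from *(1) show "T \<longlonglongrightarrow> (\<Sum>d. pmf f d * gm_weight m d)"
      unfolding T_def .
    from *(2) show "l1_norm (gm_weight m) (pmf f) = ereal (\<Sum>d. pmf f d * gm_weight m d)"
      by (subst l1_norm_eq_suminf) simp_all
  qed
  \<comment> \<open>The limit of \<open>T\<close> is finite, so a vanishing fraction of top nodes
    forces \<open>s\<close> to 0. Both regimes with \<open>c = \<infinity>\<close> reduce to this,
    since \<open>n1\<close> is eventually positive in each.\<close>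
  have dense: "s \<longlonglongrightarrow> 0"
    if pos: "\<forall>\<^sub>F n in sequentially. 0 < n1 n" and n2: "filterlim n2 at_top sequentially"
      and c: "c = \<infinity>"
    using tendsto_mult[OF layer_fraction_tendsto(2)[OF ratio pos c] T_g[OF n2]]
    by (simp add: s_eq[abs_def])
  have n1_pos: "\<forall>\<^sub>F n in sequentially. 0 < n1 n" if "filterlim n1 at_top sequentially"
    using eventually_compose_filterlim[OF eventually_gt_at_top that] .
  show ?thesis
  proof (intro conjI allI impI; elim conjE)
    fix m :: nat
    assume "0 < m" "\<forall>\<^sub>F n in sequentially. n1 n = m"
      and n2: "filterlim n2 at_top sequentially" and c: "c = \<infinity>"
    then have "\<forall>\<^sub>F n in sequentially. 0 < n1 n"
      by (auto elim: eventually_mono)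
    then show "s \<longlonglongrightarrow> 0"
      using n2 c by (rule dense)
  next
    assume "filterlim n1 at_top sequentially" "filterlim n2 at_top sequentially" "c = \<infinity>"
    then show "s \<longlonglongrightarrow> 0"
      by (intro dense n1_pos)
  next
    fix m :: nat
    assume n1: "filterlim n1 at_top sequentially" and n2: "\<forall>\<^sub>F n in sequentially. n2 n = m"
      and "c = 0"
    then have "c = ereal 0"
      by (simp add: zero_ereal_def)
    from tendsto_mult[OF layer_fraction_tendsto(1)[OF ratio n1_pos[OF n1] this] T_gm[OF n2]]
    show "(\<lambda>n. ereal (s n)) \<longlonglongrightarrow> l1_norm (gm_weight m) (pmf f)"
      by (simp add: s_eq[abs_def] norm_gm[OF n2])
  next
    assume n1: "filterlim n1 at_top sequentially" and n2: "filterlim n2 at_top sequentially"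
      and "0 \<le> c" "c < \<infinity>"
    then obtain r where r: "c = ereal r" "0 \<le> r"
      by (cases c) auto
    have "1 / (1 + c) * l1_norm g_weight (pmf f) =
        ereal (1 / (1 + r) * (\<Sum>d. pmf f d * g_weight d))"
      using r by (simp add: norm_g[OF n2] one_ereal_def)
    then show "(\<lambda>n. ereal (s n)) \<longlonglongrightarrow> 1 / (1 + c) * l1_norm g_weight (pmf f)"
      using tendsto_mult[OF layer_fraction_tendsto(1)[OF ratio n1_pos[OF n1] r(1)] T_g[OF n2]]
      by (simp add: s_eq[abs_def])
  qed
qed

end
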